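(* Let $\mathbb{C}$ be a regular unital category with binary coproducts, comonadic covers $(P,\delta,\varepsilon)$ and a natural imaginary splitting $t$. Suppose that the values of $P$ are projective objects in $\mathbb{C}$. Let $f'\colon X'\to Y'$ be a split epimorphism with section $s'$ and kernel $k'\colon K'\to X'$, let $f\colon X\to Y$ be a split epimorphism with section $s$ and kernel $k\colon K\to X$, and let $\gamma\colon K'\to K$, $g\colon X'\to X$, $h\colon Y'\to Y$ be morphisms such that $gk'=k\gamma$, $fg=hf'$ and $gs'=sh$. Let $\mathrm{Eq}(\gamma)$, $\mathrm{Eq}(g)$, $\mathrm{Eq}(h)$ be the kernel pairs of $\gamma$, $g$, $h$, and let $\varphi\colon\mathrm{Eq}(g)\to\mathrm{Eq}(h)$, with section $\sigma\colon\mathrm{Eq}(h)\to\mathrm{Eq}(g)$ and kernel $\kappa\colon\mathrm{Eq}(\gamma)\to\mathrm{Eq}(g)$, be the split epimorphism induced by $f'$, $s'$, $k'$ on kernel pairs. If $(\varphi,\sigma)$ with kernel $\kappa$ and $(f',s')$ with kernel $k'$ are intrinsic Schreier split extensions, and $g$ and $h$ are regular epimorphisms, then $(f,s)$ with kernel $k$ is also an intrinsic Schreier split extension.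
   Context: Setting. A pointed finitely complete category is unital when for all objects $A,B$ the pair $\langle 1_A,0\rangle\colon A\to A\times B$, $\langle 0,1_B\rangle\colon B\to A\times B$ is jointly extremal-epimorphic. "Comonadic covers" means a comonad $(P,\delta,\varepsilon)$ on $\mathbb{C}$ such that every $\varepsilon_X\colon P(X)\to X$ is a regular epimorphism. Projective means projective with respect to regular epimorphisms. A natural imaginary splitting is a natural transformation with components $t_{A,B}\colon P(A\times B)\to A+B$ such that $r_{A,B}t_{A,B}=\varepsilon_{A\times B}$, where $r_{A,B}\colon A+B\to A\times B$ is the canonical comparison morphism (with $\pi_A r_{A,B}=(1_A\;0)$ and $\pi_B r_{A,B}=(0\;1_B)$). Imaginary morphisms. An imaginary morphism $a\colon X\dashrightarrow Y$ is a morphism $a\colon P(X)\to Y$ in $\mathbb{C}$, i.e. a morphism of the Kleisli category of $P$; composition of $a\colon A\dashrightarrow B$ and $b\colon B\dashrightarrow C$ is $b\circ a=b\,P(a)\,\delta_A$. A real morphism $f\colon X\to Y$ of $\mathbb{C}$ is viewed as $\overline{f}=f\varepsilon_X\colon X\dashrightarrow Y$; for real $v$, $u$ one writes $v\circ a=va\;(=\overline{v}\circ a)$ and $a\circ u=aP(u)\;(=a\circ\overline{u})$. Finite products of $\mathbb{C}$ are also products for imaginary morphisms: $\langle a,b\rangle$ is the usual pairing in $\mathbb{C}$. Imaginary addition: $\mu^X\colon X\times X\dashrightarrow X$ is $\mu^X=(1_X\;1_X)\,t_{X,X}\colon P(X\times X)\to X+X\to X$. Intrinsic Schreier split epimorphism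 (also called, together with its kernel, intrinsic Schreier split extension): a split epimorphism $f\colon X\to Y$ with chosen section $s$ and kernel $k\colon K\to X$ for which there is an imaginary morphism $q\colon X\dashrightarrow K$ with $\mu^X\circ\langle k\circ q,\overline{sf}\rangle=\overline{1_X}$ and $q\circ\mu^X\circ(k\times s)=\overline{\pi_K}$, where $\pi_K\colon K\times Y\to K$ is the projection. *)

theory Defs
  imports Main
begin

section \<open>Categories, functors and finite limits\<close>

record ('o, 'm) category =
  Obj :: "'o set"
  Mor :: "'m set"
  Dom :: "'m \<Rightarrow> 'o"
  Cod :: "'m \<Rightarrow> 'o"
  Ident :: "'o \<Rightarrow> 'm" ("\<one>\<index>")
  Comp :: "'m \<Rightarrow> 'm \<Rightarrow> 'm" (infixl "\<cdot>\<index>" 70)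

definition Hom :: "('o, 'm, 'x) category_scheme \<Rightarrow> 'o \<Rightarrow> 'o \<Rightarrow> 'm set" where
  "Hom C X Y = {f \<in> Mor C. Dom C f = X \<and> Cod C f = Y}"

locale category =
  fixes C :: "('o, 'm, 'x) category_scheme" (structure)
  assumes Dom_Obj: "f \<in> Mor C \<Longrightarrow> Dom C f \<in> Obj C"
    and Cod_Obj: "f \<in> Mor C \<Longrightarrow> Cod C f \<in> Obj C"
    and Ident_Hom: "X \<in> Obj C \<Longrightarrow> \<one> X \<in> Hom C X X"
    and Comp_Hom: "f \<in> Hom C X Y \<Longrightarrow> g \<in> Hom C Y Z \<Longrightarrow> g \<cdot> f \<in> Hom C X Z"
    and Comp_assoc: "f \<in> Hom C W X \<Longrightarrow> g \<in> Hom C X Y \<Longrightarrow> h \<in> Hom C Y Z \<Longrightarrow>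
          (h \<cdot> g) \<cdot> f = h \<cdot> (g \<cdot> f)"
    and Comp_Ident: "f \<in> Hom C X Y \<Longrightarrow> f \<cdot> \<one> X = f"
    and Ident_Comp: "f \<in> Hom C X Y \<Longrightarrow> \<one> Y \<cdot> f = f"

definition is_functor ::
  "('i, 'n, 'y) category_scheme \<Rightarrow> ('o, 'm, 'x) category_scheme \<Rightarrow> ('i \<Rightarrow> 'o) \<Rightarrow> ('n \<Rightarrow> 'm) \<Rightarrow> bool" where
  "is_functor J C F\<^sub>o F\<^sub>m \<longleftrightarrow>
     (\<forall>i \<in> Obj J. F\<^sub>o i \<in> Obj C \<and> F\<^sub>m (\<one>\<^bsub>J\<^esub> i) = \<one>\<^bsub>C\<^esub> (F\<^sub>o i)) \<and>
     (\<forall>i j u. u \<in> Hom J i j \<longrightarrow> F\<^sub>m u \<in> Hom C (F\<^sub>o i) (F\<^sub>o j)) \<and>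
     (\<forall>i j l u v. u \<in> Hom J i j \<longrightarrow> v \<in> Hom J j l \<longrightarrow> F\<^sub>m (v \<cdot>\<^bsub>J\<^esub> u) = F\<^sub>m v \<cdot>\<^bsub>C\<^esub> F\<^sub>m u)"

definition is_cone ::
  "('i, 'n, 'y) category_scheme \<Rightarrow> ('o, 'm, 'x) category_scheme \<Rightarrow> ('i \<Rightarrow> 'o) \<Rightarrow> ('n \<Rightarrow> 'm) \<Rightarrow>
   'o \<Rightarrow> ('i \<Rightarrow> 'm) \<Rightarrow> bool" where
  "is_cone J C D\<^sub>o D\<^sub>m L p \<longleftrightarrow> L \<in> Obj C \<and>
     (\<forall>i \<in> Obj J. p i \<in> Hom C L (D\<^sub>o i)) \<and>
     (\<forall>i j u. u \<in> Hom J i j \<longrightarrow> D\<^sub>m u \<cdot>\<^bsub>C\<^esub> p i = p j)"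

definition is_limit ::
  "('i, 'n, 'y) category_scheme \<Rightarrow> ('o, 'm, 'x) category_scheme \<Rightarrow> ('i \<Rightarrow> 'o) \<Rightarrow> ('n \<Rightarrow> 'm) \<Rightarrow>
   'o \<Rightarrow> ('i \<Rightarrow> 'm) \<Rightarrow> bool" where
  "is_limit J C D\<^sub>o D\<^sub>m L p \<longleftrightarrow> is_cone J C D\<^sub>o D\<^sub>m L p \<and>
     (\<forall>M q. is_cone J C D\<^sub>o D\<^sub>m M q \<longrightarrow>
        (\<exists>!h. h \<in> Hom C M L \<and> (\<forall>i \<in> Obj J. p i \<cdot>\<^bsub>C\<^esub> h = q i)))"

text \<open>Every finite category is isomorphic to one whose objects and morphisms are natural numbers,
  so letting the shape \<open>J\<close> range over \<open>(nat, nat) category\<close> loses no finite diagram.\<close>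

definition finitely_complete :: "('o, 'm, 'x) category_scheme \<Rightarrow> bool" where
  "finitely_complete C \<longleftrightarrow> category C \<and>
     (\<forall>(J :: (nat, nat) category) D\<^sub>o D\<^sub>m.
        category J \<and> finite (Obj J) \<and> finite (Mor J) \<and> is_functor J C D\<^sub>o D\<^sub>m \<longrightarrow>
        (\<exists>L p. is_limit J C D\<^sub>o D\<^sub>m L p))"


section \<open>Universal constructions\<close>

definition monomorphism :: "('o, 'm, 'x) category_scheme \<Rightarrow> 'm \<Rightarrow> bool" where
  "monomorphism C m \<longleftrightarrow> m \<in> Mor C \<and>
     (\<forall>W a b. a \<in> Hom C W (Dom C m) \<longrightarrow> b \<in> Hom C W (Dom C m) \<longrightarrow>
        m \<cdot>\<^bsub>C\<^esub> a = m \<cdot>\<^bsub>C\<^esub> b \<longrightarrow> a = b)"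

definition isomorphism :: "('o, 'm, 'x) category_scheme \<Rightarrow> 'm \<Rightarrow> bool" where
  "isomorphism C m \<longleftrightarrow> m \<in> Mor C \<and>
     (\<exists>n \<in> Hom C (Cod C m) (Dom C m).
        m \<cdot>\<^bsub>C\<^esub> n = \<one>\<^bsub>C\<^esub> (Cod C m) \<and> n \<cdot>\<^bsub>C\<^esub> m = \<one>\<^bsub>C\<^esub> (Dom C m))"

definition is_product ::
  "('o, 'm, 'x) category_scheme \<Rightarrow> 'o \<Rightarrow> 'o \<Rightarrow> 'o \<Rightarrow> 'm \<Rightarrow> 'm \<Rightarrow> bool" where
  "is_product C A B Q p q \<longleftrightarrow> p \<in> Hom C Q A \<and> q \<in> Hom C Q B \<and>
     (\<forall>W a b. a \<in> Hom C W A \<longrightarrow> b \<in> Hom C W B \<longrightarrow>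
        (\<exists>!h. h \<in> Hom C W Q \<and> p \<cdot>\<^bsub>C\<^esub> h = a \<and> q \<cdot>\<^bsub>C\<^esub> h = b))"

definition is_coproduct ::
  "('o, 'm, 'x) category_scheme \<Rightarrow> 'o \<Rightarrow> 'o \<Rightarrow> 'o \<Rightarrow> 'm \<Rightarrow> 'm \<Rightarrow> bool" where
  "is_coproduct C A B Q i j \<longleftrightarrow> i \<in> Hom C A Q \<and> j \<in> Hom C B Q \<and>
     (\<forall>W a b. a \<in> Hom C A W \<longrightarrow> b \<in> Hom C B W \<longrightarrow>
        (\<exists>!h. h \<in> Hom C Q W \<and> h \<cdot>\<^bsub>C\<^esub> i = a \<and> h \<cdot>\<^bsub>C\<^esub> j = b))"

definition is_pullback ::
  "('o, 'm, 'x) category_scheme \<Rightarrow> 'm \<Rightarrow> 'm \<Rightarrow> 'o \<Rightarrow> 'm \<Rightarrow> 'm \<Rightarrow> bool" where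
  "is_pullback C f g E p q \<longleftrightarrow> f \<in> Mor C \<and> g \<in> Mor C \<and> Cod C f = Cod C g \<and>
     p \<in> Hom C E (Dom C f) \<and> q \<in> Hom C E (Dom C g) \<and> f \<cdot>\<^bsub>C\<^esub> p = g \<cdot>\<^bsub>C\<^esub> q \<and>
     (\<forall>W a b. a \<in> Hom C W (Dom C f) \<longrightarrow> b \<in> Hom C W (Dom C g) \<longrightarrow>
        f \<cdot>\<^bsub>C\<^esub> a = g \<cdot>\<^bsub>C\<^esub> b \<longrightarrow>
        (\<exists>!h. h \<in> Hom C W E \<and> p \<cdot>\<^bsub>C\<^esub> h = a \<and> q \<cdot>\<^bsub>C\<^esub> h = b))"

definition is_kernel_pair ::
  "('o, 'm, 'x) category_scheme \<Rightarrow> 'm \<Rightarrow> 'o \<Rightarrow> 'm \<Rightarrow> 'm \<Rightarrow> bool" where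
  "is_kernel_pair C f E p q \<longleftrightarrow> is_pullback C f f E p q"

definition is_coequalizer ::
  "('o, 'm, 'x) category_scheme \<Rightarrow> 'm \<Rightarrow> 'm \<Rightarrow> 'm \<Rightarrow> bool" where
  "is_coequalizer C a b e \<longleftrightarrow> a \<in> Mor C \<and> b \<in> Mor C \<and> e \<in> Mor C \<and>
     Dom C a = Dom C b \<and> Cod C a = Dom C e \<and> Cod C b = Dom C e \<and>
     e \<cdot>\<^bsub>C\<^esub> a = e \<cdot>\<^bsub>C\<^esub> b \<and>
     (\<forall>W w. w \<in> Hom C (Dom C e) W \<longrightarrow> w \<cdot>\<^bsub>C\<^esub> a = w \<cdot>\<^bsub>C\<^esub> b \<longrightarrow>
        (\<exists>!h. h \<in> Hom C (Cod C e) W \<and> h \<cdot>\<^bsub>C\<^esub> e = w))"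

definition regular_epi :: "('o, 'm, 'x) category_scheme \<Rightarrow> 'm \<Rightarrow> bool" where
  "regular_epi C e \<longleftrightarrow> (\<exists>a b. is_coequalizer C a b e)"

definition regular_category :: "('o, 'm, 'x) category_scheme \<Rightarrow> bool" where
  "regular_category C \<longleftrightarrow> finitely_complete C \<and>
     (\<forall>f E p q. is_kernel_pair C f E p q \<longrightarrow> (\<exists>e. is_coequalizer C p q e)) \<and>
     (\<forall>e g E p q. is_pullback C e g E p q \<longrightarrow> regular_epi C e \<longrightarrow> regular_epi C q)"

definition projective :: "('o, 'm, 'x) category_scheme \<Rightarrow> 'o \<Rightarrow> bool" where
  "projective C Q \<longleftrightarrow> Q \<in> Obj C \<and>
     (\<forall>e f. regular_epi C e \<longrightarrow> f \<in> Hom C Q (Cod C e) \<longrightarrow>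
        (\<exists>l \<in> Hom C Q (Dom C e). e \<cdot>\<^bsub>C\<^esub> l = f))"


section \<open>Pointed and unital categories\<close>

definition zero_object :: "('o, 'm, 'x) category_scheme \<Rightarrow> 'o \<Rightarrow> bool" where
  "zero_object C Z \<longleftrightarrow> Z \<in> Obj C \<and>
     (\<forall>X \<in> Obj C. (\<exists>!u. u \<in> Hom C X Z) \<and> (\<exists>!v. v \<in> Hom C Z X))"

definition pointed :: "('o, 'm, 'x) category_scheme \<Rightarrow> bool" where
  "pointed C \<longleftrightarrow> (\<exists>Z. zero_object C Z)"

definition zero_mor :: "('o, 'm, 'x) category_scheme \<Rightarrow> 'o \<Rightarrow> 'o \<Rightarrow> 'm" ("\<zero>\<index>") where
  "\<zero>\<^bsub>C\<^esub> X Y = (THE z. \<exists>Z u v. zero_object C Z \<and> u \<in> Hom C X Z \<and> v \<in> Hom C Z Y \<and> z = v \<cdot>\<^bsub>C\<^esub> u)"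

definition jointly_extremal_epi :: "('o, 'm, 'x) category_scheme \<Rightarrow> 'm \<Rightarrow> 'm \<Rightarrow> bool" where
  "jointly_extremal_epi C f g \<longleftrightarrow> f \<in> Mor C \<and> g \<in> Mor C \<and> Cod C f = Cod C g \<and>
     (\<forall>m a b. monomorphism C m \<longrightarrow> Cod C m = Cod C f \<longrightarrow>
        a \<in> Hom C (Dom C f) (Dom C m) \<longrightarrow> b \<in> Hom C (Dom C g) (Dom C m) \<longrightarrow>
        m \<cdot>\<^bsub>C\<^esub> a = f \<longrightarrow> m \<cdot>\<^bsub>C\<^esub> b = g \<longrightarrow> isomorphism C m)"

text \<open>In the next definition \<open>l\<close> and \<open>r\<close> are \<open>\<langle>1, 0\<rangle>\<close> and \<open>\<langle>0, 1\<rangle>\<close> for the product cone \<open>(Q, p, q)\<close>.\<close>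

definition unital_category :: "('o, 'm, 'x) category_scheme \<Rightarrow> bool" where
  "unital_category C \<longleftrightarrow> finitely_complete C \<and> pointed C \<and>
     (\<forall>A B Q p q l r. is_product C A B Q p q \<longrightarrow>
        l \<in> Hom C A Q \<longrightarrow> p \<cdot>\<^bsub>C\<^esub> l = \<one>\<^bsub>C\<^esub> A \<longrightarrow> q \<cdot>\<^bsub>C\<^esub> l = \<zero>\<^bsub>C\<^esub> A B \<longrightarrow>
        r \<in> Hom C B Q \<longrightarrow> p \<cdot>\<^bsub>C\<^esub> r = \<zero>\<^bsub>C\<^esub> B A \<longrightarrow> q \<cdot>\<^bsub>C\<^esub> r = \<one>\<^bsub>C\<^esub> B \<longrightarrow>
        jointly_extremal_epi C l r)"

definition is_kernel :: "('o, 'm, 'x) category_scheme \<Rightarrow> 'm \<Rightarrow> 'm \<Rightarrow> bool" where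
  "is_kernel C f k \<longleftrightarrow> f \<in> Mor C \<and> k \<in> Mor C \<and> Cod C k = Dom C f \<and>
     f \<cdot>\<^bsub>C\<^esub> k = \<zero>\<^bsub>C\<^esub> (Dom C k) (Cod C f) \<and>
     (\<forall>W a. a \<in> Hom C W (Dom C f) \<longrightarrow> f \<cdot>\<^bsub>C\<^esub> a = \<zero>\<^bsub>C\<^esub> W (Cod C f) \<longrightarrow>
        (\<exists>!h. h \<in> Hom C W (Dom C k) \<and> k \<cdot>\<^bsub>C\<^esub> h = a))"

definition split_epi_with_kernel ::
  "('o, 'm, 'x) category_scheme \<Rightarrow> 'o \<Rightarrow> 'o \<Rightarrow> 'o \<Rightarrow> 'm \<Rightarrow> 'm \<Rightarrow> 'm \<Rightarrow> bool" where
  "split_epi_with_kernel C K X Y k f s \<longleftrightarrow>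
     k \<in> Hom C K X \<and> f \<in> Hom C X Y \<and> s \<in> Hom C Y X \<and>
     f \<cdot>\<^bsub>C\<^esub> s = \<one>\<^bsub>C\<^esub> Y \<and> is_kernel C f k"


section \<open>Chosen products and coproducts, comonadic covers, imaginary splittings\<close>

text \<open>\<open>A \<boxtimes> B\<close> and \<open>A \<boxplus> B\<close> are the chosen product and coproduct of objects. The comonad
  \<open>(P, \<delta>, \<epsilon>)\<close> acts on objects by \<open>Cov\<close> and on morphisms by \<open>CovMap\<close>.\<close>

record ('o, 'm) imaginary_category = "('o, 'm) category" +
  Prod :: "'o \<Rightarrow> 'o \<Rightarrow> 'o" (infixr "\<boxtimes>\<index>" 80)
  Prj1 :: "'o \<Rightarrow> 'o \<Rightarrow> 'm" ("\<pi>\<^sub>1\<index>")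
  Prj2 :: "'o \<Rightarrow> 'o \<Rightarrow> 'm" ("\<pi>\<^sub>2\<index>")
  Coprod :: "'o \<Rightarrow> 'o \<Rightarrow> 'o" (infixr "\<boxplus>\<index>" 75)
  Inj1 :: "'o \<Rightarrow> 'o \<Rightarrow> 'm" ("\<iota>\<^sub>1\<index>")
  Inj2 :: "'o \<Rightarrow> 'o \<Rightarrow> 'm" ("\<iota>\<^sub>2\<index>")
  Cov :: "'o \<Rightarrow> 'o"
  CovMap :: "'m \<Rightarrow> 'm"
  Delta :: "'o \<Rightarrow> 'm" ("\<delta>\<index>")
  Eps :: "'o \<Rightarrow> 'm" ("\<epsilon>\<index>")
  Split :: "'o \<Rightarrow> 'o \<Rightarrow> 'm" ("\<tau>\<index>")

definition chosen_products :: "('o, 'm, 'x) imaginary_category_scheme \<Rightarrow> bool" where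
  "chosen_products C \<longleftrightarrow>
     (\<forall>A \<in> Obj C. \<forall>B \<in> Obj C. is_product C A B (A \<boxtimes>\<^bsub>C\<^esub> B) (\<pi>\<^sub>1\<^bsub>C\<^esub> A B) (\<pi>\<^sub>2\<^bsub>C\<^esub> A B))"

definition chosen_coproducts :: "('o, 'm, 'x) imaginary_category_scheme \<Rightarrow> bool" where
  "chosen_coproducts C \<longleftrightarrow>
     (\<forall>A \<in> Obj C. \<forall>B \<in> Obj C. is_coproduct C A B (A \<boxplus>\<^bsub>C\<^esub> B) (\<iota>\<^sub>1\<^bsub>C\<^esub> A B) (\<iota>\<^sub>2\<^bsub>C\<^esub> A B))"

definition pair :: "('o, 'm, 'x) imaginary_category_scheme \<Rightarrow> 'm \<Rightarrow> 'm \<Rightarrow> 'm" where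
  "pair C a b = (THE h. h \<in> Hom C (Dom C a) (Cod C a \<boxtimes>\<^bsub>C\<^esub> Cod C b) \<and>
     \<pi>\<^sub>1\<^bsub>C\<^esub> (Cod C a) (Cod C b) \<cdot>\<^bsub>C\<^esub> h = a \<and> \<pi>\<^sub>2\<^bsub>C\<^esub> (Cod C a) (Cod C b) \<cdot>\<^bsub>C\<^esub> h = b)"

definition copair :: "('o, 'm, 'x) imaginary_category_scheme \<Rightarrow> 'm \<Rightarrow> 'm \<Rightarrow> 'm" where
  "copair C a b = (THE h. h \<in> Hom C (Dom C a \<boxplus>\<^bsub>C\<^esub> Dom C b) (Cod C a) \<and>
     h \<cdot>\<^bsub>C\<^esub> \<iota>\<^sub>1\<^bsub>C\<^esub> (Dom C a) (Dom C b) = a \<and> h \<cdot>\<^bsub>C\<^esub> \<iota>\<^sub>2\<^bsub>C\<^esub> (Dom C a) (Dom C b) = b)"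

definition prod_map :: "('o, 'm, 'x) imaginary_category_scheme \<Rightarrow> 'm \<Rightarrow> 'm \<Rightarrow> 'm" where
  "prod_map C a b =
     pair C (a \<cdot>\<^bsub>C\<^esub> \<pi>\<^sub>1\<^bsub>C\<^esub> (Dom C a) (Dom C b)) (b \<cdot>\<^bsub>C\<^esub> \<pi>\<^sub>2\<^bsub>C\<^esub> (Dom C a) (Dom C b))"

definition coprod_map :: "('o, 'm, 'x) imaginary_category_scheme \<Rightarrow> 'm \<Rightarrow> 'm \<Rightarrow> 'm" where
  "coprod_map C a b =
     copair C (\<iota>\<^sub>1\<^bsub>C\<^esub> (Cod C a) (Cod C b) \<cdot>\<^bsub>C\<^esub> a) (\<iota>\<^sub>2\<^bsub>C\<^esub> (Cod C a) (Cod C b) \<cdot>\<^bsub>C\<^esub> b)"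

definition comparison :: "('o, 'm, 'x) imaginary_category_scheme \<Rightarrow> 'o \<Rightarrow> 'o \<Rightarrow> 'm" where
  "comparison C A B =
     pair C (copair C (\<one>\<^bsub>C\<^esub> A) (\<zero>\<^bsub>C\<^esub> B A)) (copair C (\<zero>\<^bsub>C\<^esub> A B) (\<one>\<^bsub>C\<^esub> B))"

definition comonad :: "('o, 'm, 'x) imaginary_category_scheme \<Rightarrow> bool" where
  "comonad C \<longleftrightarrow> is_functor C C (Cov C) (CovMap C) \<and>
     (\<forall>X \<in> Obj C. \<delta>\<^bsub>C\<^esub> X \<in> Hom C (Cov C X) (Cov C (Cov C X)) \<and> \<epsilon>\<^bsub>C\<^esub> X \<in> Hom C (Cov C X) X) \<and>
     (\<forall>X Y f. f \<in> Hom C X Y \<longrightarrow>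
        \<delta>\<^bsub>C\<^esub> Y \<cdot>\<^bsub>C\<^esub> CovMap C f = CovMap C (CovMap C f) \<cdot>\<^bsub>C\<^esub> \<delta>\<^bsub>C\<^esub> X \<and>
        \<epsilon>\<^bsub>C\<^esub> Y \<cdot>\<^bsub>C\<^esub> CovMap C f = f \<cdot>\<^bsub>C\<^esub> \<epsilon>\<^bsub>C\<^esub> X) \<and>
     (\<forall>X \<in> Obj C. \<epsilon>\<^bsub>C\<^esub> (Cov C X) \<cdot>\<^bsub>C\<^esub> \<delta>\<^bsub>C\<^esub> X = \<one>\<^bsub>C\<^esub> (Cov C X) \<and>
        CovMap C (\<epsilon>\<^bsub>C\<^esub> X) \<cdot>\<^bsub>C\<^esub> \<delta>\<^bsub>C\<^esub> X = \<one>\<^bsub>C\<^esub> (Cov C X) \<and>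
        \<delta>\<^bsub>C\<^esub> (Cov C X) \<cdot>\<^bsub>C\<^esub> \<delta>\<^bsub>C\<^esub> X = CovMap C (\<delta>\<^bsub>C\<^esub> X) \<cdot>\<^bsub>C\<^esub> \<delta>\<^bsub>C\<^esub> X)"

definition comonadic_covers :: "('o, 'm, 'x) imaginary_category_scheme \<Rightarrow> bool" where
  "comonadic_covers C \<longleftrightarrow> comonad C \<and> (\<forall>X \<in> Obj C. regular_epi C (\<epsilon>\<^bsub>C\<^esub> X))"

definition natural_imaginary_splitting :: "('o, 'm, 'x) imaginary_category_scheme \<Rightarrow> bool" where
  "natural_imaginary_splitting C \<longleftrightarrow>
     (\<forall>A \<in> Obj C. \<forall>B \<in> Obj C.
        \<tau>\<^bsub>C\<^esub> A B \<in> Hom C (Cov C (A \<boxtimes>\<^bsub>C\<^esub> B)) (A \<boxplus>\<^bsub>C\<^esub> B) \<and>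
        comparison C A B \<cdot>\<^bsub>C\<^esub> \<tau>\<^bsub>C\<^esub> A B = \<epsilon>\<^bsub>C\<^esub> (A \<boxtimes>\<^bsub>C\<^esub> B)) \<and>
     (\<forall>A A' B B' a b. a \<in> Hom C A A' \<longrightarrow> b \<in> Hom C B B' \<longrightarrow>
        coprod_map C a b \<cdot>\<^bsub>C\<^esub> \<tau>\<^bsub>C\<^esub> A B = \<tau>\<^bsub>C\<^esub> A' B' \<cdot>\<^bsub>C\<^esub> CovMap C (prod_map C a b))"


section \<open>Imaginary morphisms and intrinsic Schreier split extensions\<close>

text \<open>An imaginary morphism from \<open>X\<close> to \<open>Y\<close> is an element of \<open>Hom C (Cov C X) Y\<close>. Since \<open>X\<close> cannot
  be recovered from the object \<open>Cov C X\<close>, the composite takes the imaginary domain \<open>X\<close> of \<open>a\<close> as an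
  argument.\<close>

definition imaginary :: "('o, 'm, 'x) imaginary_category_scheme \<Rightarrow> 'o \<Rightarrow> 'o \<Rightarrow> 'm set" where
  "imaginary C X Y = Hom C (Cov C X) Y"

definition imaginary_comp :: "('o, 'm, 'x) imaginary_category_scheme \<Rightarrow> 'o \<Rightarrow> 'm \<Rightarrow> 'm \<Rightarrow> 'm" where
  "imaginary_comp C X b a = b \<cdot>\<^bsub>C\<^esub> CovMap C a \<cdot>\<^bsub>C\<^esub> \<delta>\<^bsub>C\<^esub> X"

definition real_imaginary :: "('o, 'm, 'x) imaginary_category_scheme \<Rightarrow> 'm \<Rightarrow> 'm" where
  "real_imaginary C f = f \<cdot>\<^bsub>C\<^esub> \<epsilon>\<^bsub>C\<^esub> (Dom C f)"

definition imaginary_addition :: "('o, 'm, 'x) imaginary_category_scheme \<Rightarrow> 'o \<Rightarrow> 'm" ("\<mu>\<index>") where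
  "\<mu>\<^bsub>C\<^esub> X = copair C (\<one>\<^bsub>C\<^esub> X) (\<one>\<^bsub>C\<^esub> X) \<cdot>\<^bsub>C\<^esub> \<tau>\<^bsub>C\<^esub> X X"

text \<open>For real \<open>v\<close> and \<open>u\<close>, the composite \<open>v \<circ> a\<close> is \<open>v \<cdot> a\<close>, and \<open>a \<circ> u\<close> is \<open>a \<cdot> CovMap C u\<close>.\<close>

definition intrinsic_Schreier ::
  "('o, 'm, 'x) imaginary_category_scheme \<Rightarrow> 'o \<Rightarrow> 'o \<Rightarrow> 'o \<Rightarrow> 'm \<Rightarrow> 'm \<Rightarrow> 'm \<Rightarrow> bool" where
  "intrinsic_Schreier C K X Y k f s \<longleftrightarrow> split_epi_with_kernel C K X Y k f s \<and>
     (\<exists>q \<in> imaginary C X K.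
        imaginary_comp C X (\<mu>\<^bsub>C\<^esub> X) (pair C (k \<cdot>\<^bsub>C\<^esub> q) (real_imaginary C (s \<cdot>\<^bsub>C\<^esub> f)))
          = real_imaginary C (\<one>\<^bsub>C\<^esub> X) \<and>
        imaginary_comp C (K \<boxtimes>\<^bsub>C\<^esub> Y) q (\<mu>\<^bsub>C\<^esub> X \<cdot>\<^bsub>C\<^esub> CovMap C (prod_map C k s))
          = real_imaginary C (\<pi>\<^sub>1\<^bsub>C\<^esub> K Y))"

end

theory Submission
  imports Defs
begin

text \<open>The proof is a calculation with imaginary elements \<open>x : P W \<rightarrow> X\<close> of the
  objects concerned. They can be added, by \<open>a + b = \<mu> \<circ> \<langle>a, b\<rangle>\<close>; this
  addition is preserved by real morphisms and by substitution, and zero is a right unit for it. In this language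
  \<open>q\<close> witnesses the Schreier condition for \<open>(f, s)\<close> with kernel \<open>k\<close>
  exactly when \<open>x = k q(x) + s f x\<close> and \<open>q(k c + s d) = c\<close> hold for all imaginary
  elements \<open>x\<close>, \<open>c\<close>, \<open>d\<close> (\<open>intrinsic_Schreier_iff\<close>). So the
  \<open>K\<close>-part of an element is determined by its decomposition, and morphisms of Schreier extensions
  commute with the retractions \<open>q\<close> (\<open>Schreier_retraction_natural\<close>).

  The objects \<open>P W\<close> are projective and \<open>g\<close> is a regular epimorphism, so every
  imaginary element \<open>x\<close> of \<open>X\<close> is \<open>g x'\<close> for some \<open>x'\<close> of
  \<open>X'\<close>, and one is led to put \<open>q(x) = \<gamma> q'(x')\<close>. This does not depend on
  \<open>x'\<close>: if \<open>g x' = g x''\<close>, then \<open>x'\<close> and \<open>x''\<close> are the two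
  projections of an element \<open>e\<close> of \<open>Eq(g)\<close>; naturality along the two projections from
  the Schreier extension of kernel pairs, with retraction \<open>r\<close>, gives \<open>q'(x') =
  \<gamma>\<^sub>1 r(e)\<close> and \<open>q'(x'') = \<gamma>\<^sub>2 r(e)\<close>, and \<open>\<gamma>\<close>
  identifies these two.

  Applying \<open>g\<close> to the decomposition of \<open>x'\<close> yields that of \<open>x\<close>. For the
  second equation one wants \<open>c = \<gamma> c'\<close> and \<open>d = h d'\<close>, since then \<open>k c +
  s d = g (k' c' + s' d')\<close>. The element \<open>d'\<close> exists because \<open>h\<close> is a regular
  epimorphism. It is not given in advance that \<open>\<gamma>\<close> is one too; to find \<open>c'\<close>,
  note instead that the first equation at \<open>k c\<close> reads \<open>k c = k q(k c) + 0\<close>, hence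
  \<open>c = q(k c)\<close> (\<open>Schreier_retraction_kernel\<close>), and the right-hand side lies in the
  image of \<open>\<gamma>\<close> by the construction of \<open>q\<close>.\<close>


section \<open>Zero morphisms, kernels and lifting\<close>

context category
begin

lemma Hom_Obj: "f \<in> Hom C X Y \<Longrightarrow> X \<in> Obj C \<and> Y \<in> Obj C"
  using Dom_Obj Cod_Obj by (auto simp: Hom_def)

text \<open>The description defining the zero morphism is well posed: two zero objects are connected by a
  comparison map which is compatible with all maps into and out of them.\<close>

lemma zero_mor_eq:
  assumes Z: "zero_object C Z" and u: "u \<in> Hom C X Z" and v: "v \<in> Hom C Z Y"
  shows "\<zero> X Y = v \<cdot> u"
  unfolding zero_mor_def
proof (rule the_equality)
  show "\<exists>Z u' v'. zero_object C Z \<and> u' \<in> Hom C X Z \<and> v' \<in> Hom C Z Y \<and> v \<cdot> u = v' \<cdot> u'"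
    using assms by blast
next
  fix z assume "\<exists>Z u v. zero_object C Z \<and> u \<in> Hom C X Z \<and> v \<in> Hom C Z Y \<and> z = v \<cdot> u"
  then obtain Z' u' v' where Z': "zero_object C Z'" and u': "u' \<in> Hom C X Z'"
    and v': "v' \<in> Hom C Z' Y" and z: "z = v' \<cdot> u'"
    by blast
  have "Z \<in> Obj C" using Z by (simp add: zero_object_def)
  then obtain w where w: "w \<in> Hom C Z Z'"
    using Z' unfolding zero_object_def by blast
  have "w \<cdot> u = u'"
    using Comp_Hom[OF u w] u' Z' Hom_Obj[OF u] unfolding zero_object_def by blast
  moreover have "v' \<cdot> w = v"
    using Comp_Hom[OF w v'] v Z Hom_Obj[OF v] unfolding zero_object_def by blast
  ultimately show "z = v \<cdot> u"
    using Comp_assoc[OF u w v'] z by simp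
qed

lemma zero_mor_factorization:
  assumes "zero_object C Z" and "X \<in> Obj C" and "Y \<in> Obj C"
  obtains u v where "u \<in> Hom C X Z" and "v \<in> Hom C Z Y" and "\<zero> X Y = v \<cdot> u"
proof -
  have "\<exists>u. u \<in> Hom C X Z" and "\<exists>v. v \<in> Hom C Z Y"
    using assms unfolding zero_object_def by (meson ex1_implies_ex)+
  then obtain u v where u: "u \<in> Hom C X Z" and v: "v \<in> Hom C Z Y" by blast
  show thesis by (rule that[OF u v zero_mor_eq[OF assms(1) u v]])
qed

lemma zero_mor_Comp:
  assumes "zero_object C Z" and a: "a \<in> Hom C W X" and "Y \<in> Obj C"
  shows "\<zero> X Y \<cdot> a = \<zero> W Y"
proof -
  have X: "X \<in> Obj C" using Hom_Obj[OF a] by simp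
  obtain u v where uv: "u \<in> Hom C X Z" "v \<in> Hom C Z Y" "\<zero> X Y = v \<cdot> u"
    using zero_mor_factorization[OF assms(1) X assms(3)] .
  then show ?thesis
    using zero_mor_eq[OF assms(1) Comp_Hom[OF a uv(1)] uv(2)] Comp_assoc[OF a uv(1,2)] by simp
qed

lemma kernel_cancel:
  assumes Z: "zero_object C Z" and kf: "is_kernel C f k" and k: "k \<in> Hom C K X"
    and a: "a \<in> Hom C W K" and b: "b \<in> Hom C W K" and eq: "k \<cdot> a = k \<cdot> b"
  shows "a = b"
proof -
  have Dk: "Dom C k = K" and Ck: "Cod C k = X" using k by (simp_all add: Hom_def)
  note kf' = kf[unfolded is_kernel_def Dk Ck]
  have f: "f \<in> Hom C X (Cod C f)" and fk: "f \<cdot> k = \<zero> K (Cod C f)"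
    using kf' by (simp_all add: Hom_def)
  have uniq: "\<exists>!h. h \<in> Hom C V K \<and> k \<cdot> h = c"
    if "c \<in> Hom C V X" and "f \<cdot> c = \<zero> V (Cod C f)" for V c
  proof -
    have "X = Dom C f" using kf' by blast
    then show ?thesis using kf' that by blast
  qed
  have "f \<cdot> (k \<cdot> a) = \<zero> W (Cod C f)"
    using Comp_assoc[OF a k f] fk zero_mor_Comp[OF Z a] Hom_Obj[OF f] by simp
  then show ?thesis
    using uniq[OF Comp_Hom[OF a k]] a b eq by metis
qed

lemma kernel_pair_props:
  assumes E: "is_kernel_pair C f E p q" and f: "f \<in> Hom C X Y"
  shows "p \<in> Hom C E X" and "q \<in> Hom C E X" and "f \<cdot> p = f \<cdot> q"
  using E f by (auto simp: is_kernel_pair_def is_pullback_def Hom_def)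

lemma kernel_pair_lift:
  assumes E: "is_kernel_pair C f E p q" and f: "f \<in> Hom C X Y"
    and x: "x \<in> Hom C W X" and y: "y \<in> Hom C W X" and "f \<cdot> x = f \<cdot> y"
  obtains e where "e \<in> Hom C W E" and "p \<cdot> e = x" and "q \<cdot> e = y"
proof -
  have D: "Dom C f = X" using f by (simp add: Hom_def)
  have "\<exists>!e. e \<in> Hom C W E \<and> p \<cdot> e = x \<and> q \<cdot> e = y"
    using E[unfolded is_kernel_pair_def is_pullback_def D] assms(3-5) by blast
  from ex1_implies_ex[OF this] show thesis using that by blast
qed

lemma projective_lift:
  assumes "projective C Q" and "regular_epi C e" and e: "e \<in> Hom C X Y" and "a \<in> Hom C Q Y"
  obtains l where "l \<in> Hom C Q X" and "e \<cdot> l = a"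
proof -
  have "Dom C e = X" and "Cod C e = Y" using e by (simp_all add: Hom_def)
  then have "\<exists>l \<in> Hom C Q X. e \<cdot> l = a" using assms unfolding projective_def by blast
  then show thesis using that by blast
qed

end


section \<open>Products, coproducts and the comonad\<close>

locale imaginary_splitting_category = category C
  for C :: "('o, 'm, 'x) imaginary_category_scheme" (structure) +
  assumes pointed: "pointed C"
    and products: "chosen_products C" and coproducts: "chosen_coproducts C"
    and comonad: "comonad C" and splitting: "natural_imaginary_splitting C"
begin

lemma Prj_Hom:
  assumes "A \<in> Obj C" "B \<in> Obj C"
  shows "\<pi>\<^sub>1 A B \<in> Hom C (A \<boxtimes> B) A" and "\<pi>\<^sub>2 A B \<in> Hom C (A \<boxtimes> B) B"
  using products assms unfolding chosen_products_def is_product_def by blast+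

lemma pair_unique:
  assumes a: "a \<in> Hom C W A" and b: "b \<in> Hom C W B"
  shows "\<exists>!h. h \<in> Hom C W (A \<boxtimes> B) \<and> \<pi>\<^sub>1 A B \<cdot> h = a \<and> \<pi>\<^sub>2 A B \<cdot> h = b"
proof -
  have "is_product C A B (A \<boxtimes> B) (\<pi>\<^sub>1 A B) (\<pi>\<^sub>2 A B)"
    using products Hom_Obj[OF a] Hom_Obj[OF b] unfolding chosen_products_def by blast
  then show ?thesis using a b unfolding is_product_def by blast
qed

lemma pair_props:
  assumes a: "a \<in> Hom C W A" and b: "b \<in> Hom C W B"
  shows "pair C a b \<in> Hom C W (A \<boxtimes> B)"
    and "\<pi>\<^sub>1 A B \<cdot> pair C a b = a" and "\<pi>\<^sub>2 A B \<cdot> pair C a b = b"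
proof -
  have D: "Cod C a = A" "Cod C b = B" "Dom C a = W"
    using a b by (simp_all add: Hom_def)
  note h = theI'[OF pair_unique[OF a b], folded pair_def[of C a b, unfolded D]]
  show "pair C a b \<in> Hom C W (A \<boxtimes> B)" "\<pi>\<^sub>1 A B \<cdot> pair C a b = a" "\<pi>\<^sub>2 A B \<cdot> pair C a b = b"
    using h by blast+
qed

lemma pair_eqI:
  assumes h: "h \<in> Hom C W (A \<boxtimes> B)" and a: "\<pi>\<^sub>1 A B \<cdot> h = a" and b: "\<pi>\<^sub>2 A B \<cdot> h = b"
    and A: "A \<in> Obj C" and B: "B \<in> Obj C"
  shows "pair C a b = h"
proof -
  have "a \<in> Hom C W A" "b \<in> Hom C W B"
    using Comp_Hom[OF h] Prj_Hom[OF A B] a b by auto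
  then show ?thesis
    using pair_unique[of a W A b B] pair_props[of a W A b B] h a b by metis
qed

lemma pair_Comp:
  assumes a: "a \<in> Hom C W A" and b: "b \<in> Hom C W B" and w: "w \<in> Hom C V W"
  shows "pair C a b \<cdot> w = pair C (a \<cdot> w) (b \<cdot> w)"
proof -
  note p = pair_props[OF a b]
  have AB: "A \<in> Obj C" "B \<in> Obj C" using Hom_Obj[OF a] Hom_Obj[OF b] by auto
  show ?thesis
    using pair_eqI[OF Comp_Hom[OF w p(1)] _ _ AB]
      Comp_assoc[OF w p(1) Prj_Hom(1)[OF AB]] Comp_assoc[OF w p(1) Prj_Hom(2)[OF AB]] p
    by simp
qed

lemma prod_map_Hom:
  assumes a: "a \<in> Hom C A A'" and b: "b \<in> Hom C B B'"
  shows "prod_map C a b \<in> Hom C (A \<boxtimes> B) (A' \<boxtimes> B')"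
proof -
  have AB: "A \<in> Obj C" "B \<in> Obj C" using Hom_Obj[OF a] Hom_Obj[OF b] by auto
  have D: "Dom C a = A" "Dom C b = B" using a b by (auto simp: Hom_def)
  show ?thesis unfolding prod_map_def D
    using pair_props(1)[OF Comp_Hom[OF Prj_Hom(1)[OF AB] a] Comp_Hom[OF Prj_Hom(2)[OF AB] b]] .
qed

lemma prod_map_pair:
  assumes a: "a \<in> Hom C A A'" and b: "b \<in> Hom C B B'" and x: "x \<in> Hom C W A" and y: "y \<in> Hom C W B"
  shows "prod_map C a b \<cdot> pair C x y = pair C (a \<cdot> x) (b \<cdot> y)"
proof -
  have AB: "A \<in> Obj C" "B \<in> Obj C" using Hom_Obj[OF a] Hom_Obj[OF b] by auto
  have D: "Dom C a = A" "Dom C b = B" using a b by (auto simp: Hom_def)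
  note p = pair_props[OF x y] and P = Prj_Hom[OF AB]
  show ?thesis unfolding prod_map_def D
    using pair_Comp[OF Comp_Hom[OF P(1) a] Comp_Hom[OF P(2) b] p(1)]
      Comp_assoc[OF p(1) P(1) a] Comp_assoc[OF p(1) P(2) b] p(2,3) by simp
qed

lemma Inj_Hom:
  assumes "A \<in> Obj C" "B \<in> Obj C"
  shows "\<iota>\<^sub>1 A B \<in> Hom C A (A \<boxplus> B)" and "\<iota>\<^sub>2 A B \<in> Hom C B (A \<boxplus> B)"
  using coproducts assms unfolding chosen_coproducts_def is_coproduct_def by blast+

lemma copair_unique:
  assumes a: "a \<in> Hom C A W" and b: "b \<in> Hom C B W"
  shows "\<exists>!h. h \<in> Hom C (A \<boxplus> B) W \<and> h \<cdot> \<iota>\<^sub>1 A B = a \<and> h \<cdot> \<iota>\<^sub>2 A B = b"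
proof -
  have "is_coproduct C A B (A \<boxplus> B) (\<iota>\<^sub>1 A B) (\<iota>\<^sub>2 A B)"
    using coproducts Hom_Obj[OF a] Hom_Obj[OF b] unfolding chosen_coproducts_def by blast
  then show ?thesis using a b unfolding is_coproduct_def by blast
qed

lemma copair_props:
  assumes a: "a \<in> Hom C A W" and b: "b \<in> Hom C B W"
  shows "copair C a b \<in> Hom C (A \<boxplus> B) W"
    and "copair C a b \<cdot> \<iota>\<^sub>1 A B = a" and "copair C a b \<cdot> \<iota>\<^sub>2 A B = b"
proof -
  have D: "Dom C a = A" "Dom C b = B" "Cod C a = W"
    using a b by (simp_all add: Hom_def)
  note h = theI'[OF copair_unique[OF a b], folded copair_def[of C a b, unfolded D]]
  show "copair C a b \<in> Hom C (A \<boxplus> B) W"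
    "copair C a b \<cdot> \<iota>\<^sub>1 A B = a" "copair C a b \<cdot> \<iota>\<^sub>2 A B = b"
    using h by blast+
qed

lemma copair_eqI:
  assumes h: "h \<in> Hom C (A \<boxplus> B) W" and a: "h \<cdot> \<iota>\<^sub>1 A B = a" and b: "h \<cdot> \<iota>\<^sub>2 A B = b"
    and A: "A \<in> Obj C" and B: "B \<in> Obj C"
  shows "copair C a b = h"
proof -
  have "a \<in> Hom C A W" "b \<in> Hom C B W"
    using Comp_Hom[OF _ h] Inj_Hom[OF A B] a b by auto
  then show ?thesis
    using copair_unique[of a A W b B] copair_props[of a A W b B] h a b by metis
qed

lemma Comp_copair:
  assumes a: "a \<in> Hom C A W" and b: "b \<in> Hom C B W" and w: "w \<in> Hom C W V"
  shows "w \<cdot> copair C a b = copair C (w \<cdot> a) (w \<cdot> b)"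
proof -
  note p = copair_props[OF a b]
  have AB: "A \<in> Obj C" "B \<in> Obj C" using Hom_Obj[OF a] Hom_Obj[OF b] by auto
  show ?thesis
    using copair_eqI[OF Comp_Hom[OF p(1) w] _ _ AB]
      Comp_assoc[OF Inj_Hom(1)[OF AB] p(1) w] Comp_assoc[OF Inj_Hom(2)[OF AB] p(1) w] p
    by simp
qed

lemma coprod_map_Hom:
  assumes a: "a \<in> Hom C A A'" and b: "b \<in> Hom C B B'"
  shows "coprod_map C a b \<in> Hom C (A \<boxplus> B) (A' \<boxplus> B')"
proof -
  have AB: "A' \<in> Obj C" "B' \<in> Obj C" using Hom_Obj[OF a] Hom_Obj[OF b] by auto
  have D: "Cod C a = A'" "Cod C b = B'" using a b by (auto simp: Hom_def)
  show ?thesis unfolding coprod_map_def D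
    using copair_props(1)[OF Comp_Hom[OF a Inj_Hom(1)[OF AB]] Comp_Hom[OF b Inj_Hom(2)[OF AB]]] .
qed

lemma copair_coprod_map:
  assumes a: "a \<in> Hom C A A'" and b: "b \<in> Hom C B B'"
    and x: "x \<in> Hom C A' W" and y: "y \<in> Hom C B' W"
  shows "copair C x y \<cdot> coprod_map C a b = copair C (x \<cdot> a) (y \<cdot> b)"
proof -
  have AB: "A' \<in> Obj C" "B' \<in> Obj C" using Hom_Obj[OF a] Hom_Obj[OF b] by auto
  have D: "Cod C a = A'" "Cod C b = B'" using a b by (auto simp: Hom_def)
  note p = copair_props[OF x y] and I = Inj_Hom[OF AB]
  show ?thesis unfolding coprod_map_def D
    using Comp_copair[OF Comp_Hom[OF a I(1)] Comp_Hom[OF b I(2)] p(1)]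
      Comp_assoc[OF a I(1) p(1)] Comp_assoc[OF b I(2) p(1)] p(2,3) by simp
qed

lemma CovMap_Hom: "f \<in> Hom C X Y \<Longrightarrow> CovMap C f \<in> Hom C (Cov C X) (Cov C Y)"
  and CovMap_Comp: "f \<in> Hom C X Y \<Longrightarrow> g \<in> Hom C Y Z \<Longrightarrow>
    CovMap C (g \<cdot> f) = CovMap C g \<cdot> CovMap C f"
  and Delta_Hom: "X \<in> Obj C \<Longrightarrow> \<delta> X \<in> Hom C (Cov C X) (Cov C (Cov C X))"
  and Eps_Hom: "X \<in> Obj C \<Longrightarrow> \<epsilon> X \<in> Hom C (Cov C X) X"
  and Delta_natural: "f \<in> Hom C X Y \<Longrightarrow> \<delta> Y \<cdot> CovMap C f = CovMap C (CovMap C f) \<cdot> \<delta> X"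
  and Eps_natural: "f \<in> Hom C X Y \<Longrightarrow> \<epsilon> Y \<cdot> CovMap C f = f \<cdot> \<epsilon> X"
  and Eps_Delta: "X \<in> Obj C \<Longrightarrow> \<epsilon> (Cov C X) \<cdot> \<delta> X = \<one> (Cov C X)"
  and CovMap_Eps_Delta: "X \<in> Obj C \<Longrightarrow> CovMap C (\<epsilon> X) \<cdot> \<delta> X = \<one> (Cov C X)"
  and Delta_Delta: "X \<in> Obj C \<Longrightarrow> \<delta> (Cov C X) \<cdot> \<delta> X = CovMap C (\<delta> X) \<cdot> \<delta> X"
  using comonad unfolding comonad_def is_functor_def by blast+

lemma Split_Hom: "A \<in> Obj C \<Longrightarrow> B \<in> Obj C \<Longrightarrow> \<tau> A B \<in> Hom C (Cov C (A \<boxtimes> B)) (A \<boxplus> B)"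
  and comparison_Split: "A \<in> Obj C \<Longrightarrow> B \<in> Obj C \<Longrightarrow> comparison C A B \<cdot> \<tau> A B = \<epsilon> (A \<boxtimes> B)"
  and Split_natural: "a \<in> Hom C A A' \<Longrightarrow> b \<in> Hom C B B' \<Longrightarrow>
    coprod_map C a b \<cdot> \<tau> A B = \<tau> A' B' \<cdot> CovMap C (prod_map C a b)"
  using splitting unfolding natural_imaginary_splitting_def by blast+


section \<open>Imaginary morphisms and their addition\<close>

text \<open>The index records the domain of the imaginary morphism on the right, which cannot be read off
  from its source \<open>P W\<close>.\<close>

abbreviation imag_comp ("(_ \<star>\<^bsub>_\<^esub> _)" [71, 0, 70] 70) where
  "b \<star>\<^bsub>W\<^esub> a \<equiv> imaginary_comp C W b a"

definition imag_add ("(_ \<oplus>\<^bsub>_,_\<^esub> _)" [66, 0, 0, 65] 65) where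
  "a \<oplus>\<^bsub>W,X\<^esub> b = \<mu> X \<star>\<^bsub>W\<^esub> pair C a b"

lemma imag_comp_Hom:
  assumes a: "a \<in> Hom C (Cov C W) A" and b: "b \<in> Hom C (Cov C A) B" and W: "W \<in> Obj C"
  shows "b \<star>\<^bsub>W\<^esub> a \<in> Hom C (Cov C W) B"
  unfolding imaginary_comp_def
  using Comp_Hom[OF Delta_Hom[OF W] Comp_Hom[OF CovMap_Hom[OF a] b]] .

lemma Comp_imag_comp:
  assumes a: "a \<in> Hom C (Cov C W) A" and b: "b \<in> Hom C (Cov C A) B" and W: "W \<in> Obj C"
    and v: "v \<in> Hom C B D"
  shows "(v \<cdot> b) \<star>\<^bsub>W\<^esub> a = v \<cdot> (b \<star>\<^bsub>W\<^esub> a)"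
  unfolding imaginary_comp_def
  using Comp_assoc[OF CovMap_Hom[OF a] b v]
    Comp_assoc[OF Delta_Hom[OF W] Comp_Hom[OF CovMap_Hom[OF a] b] v] by simp

lemma imag_comp_real:
  assumes a: "a \<in> Hom C (Cov C W) A" and W: "W \<in> Obj C" and v: "v \<in> Hom C A B"
    and b: "b \<in> Hom C (Cov C B) D"
  shows "b \<star>\<^bsub>W\<^esub> (v \<cdot> a) = (b \<cdot> CovMap C v) \<star>\<^bsub>W\<^esub> a"
  unfolding imaginary_comp_def
  using CovMap_Comp[OF a v] Comp_assoc[OF CovMap_Hom[OF a] CovMap_Hom[OF v] b] by simp

lemma imag_comp_Eps_left:
  assumes a: "a \<in> Hom C (Cov C W) A" and W: "W \<in> Obj C"
  shows "\<epsilon> A \<star>\<^bsub>W\<^esub> a = a"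
proof -
  have PW: "Cov C W \<in> Obj C" using Hom_Obj[OF a] by simp
  have "\<epsilon> A \<star>\<^bsub>W\<^esub> a = a \<cdot> (\<epsilon> (Cov C W) \<cdot> \<delta> W)"
    unfolding imaginary_comp_def
    using Eps_natural[OF a] Comp_assoc[OF Delta_Hom[OF W] Eps_Hom[OF PW] a] by simp
  then show ?thesis using Eps_Delta[OF W] Comp_Ident[OF a] by simp
qed

lemma imag_comp_real_Eps:
  assumes a: "a \<in> Hom C (Cov C A) B" and u: "u \<in> Hom C W A"
  shows "a \<star>\<^bsub>W\<^esub> (u \<cdot> \<epsilon> W) = a \<cdot> CovMap C u"
proof -
  have W: "W \<in> Obj C" using Hom_Obj[OF u] by simp
  have "a \<star>\<^bsub>W\<^esub> (u \<cdot> \<epsilon> W) = (a \<cdot> CovMap C u) \<cdot> (CovMap C (\<epsilon> W) \<cdot> \<delta> W)"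
    using imag_comp_real[OF Eps_Hom[OF W] W u a, unfolded imaginary_comp_def]
      Comp_assoc[OF Delta_Hom[OF W] CovMap_Hom[OF Eps_Hom[OF W]] Comp_Hom[OF CovMap_Hom[OF u] a]]
    by (simp add: imaginary_comp_def)
  then show ?thesis
    using CovMap_Eps_Delta[OF W] Comp_Ident[OF Comp_Hom[OF CovMap_Hom[OF u] a]] by simp
qed

lemma imag_comp_Eps_right:
  assumes a: "a \<in> Hom C (Cov C W) A" and W: "W \<in> Obj C"
  shows "a \<star>\<^bsub>W\<^esub> \<epsilon> W = a"
  unfolding imaginary_comp_def
  using CovMap_Eps_Delta[OF W] Comp_Ident[OF a]
    Comp_assoc[OF Delta_Hom[OF W] CovMap_Hom[OF Eps_Hom[OF W]] a] by simp

text \<open>Associativity of composition in the Kleisli category of \<open>P\<close>: naturality of \<open>\<delta>\<close> moves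
  \<open>P a\<close> past \<open>\<delta>\<close>, and coassociativity identifies the two ways of duplicating.\<close>

lemma imag_comp_assoc:
  assumes a: "a \<in> Hom C (Cov C W) A" and b: "b \<in> Hom C (Cov C A) B" and c: "c \<in> Hom C (Cov C B) D"
    and W: "W \<in> Obj C" and A: "A \<in> Obj C"
  shows "(c \<star>\<^bsub>A\<^esub> b) \<star>\<^bsub>W\<^esub> a = c \<star>\<^bsub>W\<^esub> (b \<star>\<^bsub>W\<^esub> a)"
proof -
  note Pa = CovMap_Hom[OF a] and Pb = CovMap_Hom[OF b] and dA = Delta_Hom[OF A] and dW = Delta_Hom[OF W]
  note PPa = CovMap_Hom[OF Pa]
  have PW: "Cov C W \<in> Obj C" using Hom_Obj[OF a] by simp
  have cPb: "c \<cdot> CovMap C b \<in> Hom C (Cov C (Cov C A)) D" using Comp_Hom[OF Pb c] .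
  have "(c \<star>\<^bsub>A\<^esub> b) \<star>\<^bsub>W\<^esub> a = ((c \<cdot> CovMap C b) \<cdot> (\<delta> A \<cdot> CovMap C a)) \<cdot> \<delta> W"
    unfolding imaginary_comp_def using Comp_assoc[OF Pa dA cPb] by simp
  also have "\<dots> = ((c \<cdot> CovMap C b) \<cdot> (CovMap C (CovMap C a) \<cdot> \<delta> (Cov C W))) \<cdot> \<delta> W"
    using Delta_natural[OF a] by simp
  also have "\<dots> = ((c \<cdot> CovMap C b) \<cdot> CovMap C (CovMap C a)) \<cdot> (\<delta> (Cov C W) \<cdot> \<delta> W)"
    using Comp_assoc[OF Delta_Hom[OF PW] PPa cPb]
      Comp_assoc[OF dW Delta_Hom[OF PW] Comp_Hom[OF PPa cPb]] by simp
  also have "\<dots> = (c \<cdot> (CovMap C b \<cdot> CovMap C (CovMap C a))) \<cdot> (CovMap C (\<delta> W) \<cdot> \<delta> W)"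
    using Comp_assoc[OF PPa Pb c] Delta_Delta[OF W] by simp
  also have "\<dots> = (c \<cdot> CovMap C (b \<cdot> CovMap C a)) \<cdot> (CovMap C (\<delta> W) \<cdot> \<delta> W)"
    using CovMap_Comp[OF Pa b] by simp
  also have "\<dots> = (c \<cdot> (CovMap C (b \<cdot> CovMap C a) \<cdot> CovMap C (\<delta> W))) \<cdot> \<delta> W"
    using Comp_assoc[OF dW CovMap_Hom[OF dW] Comp_Hom[OF CovMap_Hom[OF Comp_Hom[OF Pa b]] c]]
      Comp_assoc[OF CovMap_Hom[OF dW] CovMap_Hom[OF Comp_Hom[OF Pa b]] c] by simp
  also have "\<dots> = c \<star>\<^bsub>W\<^esub> (b \<star>\<^bsub>W\<^esub> a)"
    unfolding imaginary_comp_def using CovMap_Comp[OF dW Comp_Hom[OF Pa b]] by simp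
  finally show ?thesis .
qed

lemma pair_imag_comp:
  assumes a: "a \<in> Hom C (Cov C W) A" and b: "b \<in> Hom C (Cov C W) B" and c: "c \<in> Hom C (Cov C V) W"
    and V: "V \<in> Obj C"
  shows "pair C a b \<star>\<^bsub>V\<^esub> c = pair C (a \<star>\<^bsub>V\<^esub> c) (b \<star>\<^bsub>V\<^esub> c)"
  unfolding imaginary_comp_def
  using pair_Comp[OF a b CovMap_Hom[OF c]]
    pair_Comp[OF Comp_Hom[OF CovMap_Hom[OF c] a] Comp_Hom[OF CovMap_Hom[OF c] b] Delta_Hom[OF V]]
  by simp

lemma imaginary_addition_Hom: "X \<in> Obj C \<Longrightarrow> \<mu> X \<in> Hom C (Cov C (X \<boxtimes> X)) X"
  unfolding imaginary_addition_def
  using Comp_Hom[OF Split_Hom copair_props(1)[OF Ident_Hom Ident_Hom]] by blast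

lemma imaginary_addition_natural:
  assumes f: "f \<in> Hom C X Y"
  shows "f \<cdot> \<mu> X = \<mu> Y \<cdot> CovMap C (prod_map C f f)"
proof -
  have X: "X \<in> Obj C" and Y: "Y \<in> Obj C" using Hom_Obj[OF f] by auto
  note t = Split_Hom[OF X X] and t' = Split_Hom[OF Y Y] and m = coprod_map_Hom[OF f f]
  note nX = copair_props(1)[OF Ident_Hom[OF X] Ident_Hom[OF X]]
    and nY = copair_props(1)[OF Ident_Hom[OF Y] Ident_Hom[OF Y]]
  have "f \<cdot> \<mu> X = copair C f f \<cdot> \<tau> X X"
    unfolding imaginary_addition_def
    using Comp_assoc[OF t nX f] Comp_copair[OF Ident_Hom[OF X] Ident_Hom[OF X] f] Comp_Ident[OF f]
    by simp
  also have "copair C f f = copair C (\<one> Y) (\<one> Y) \<cdot> coprod_map C f f"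
    using copair_coprod_map[OF f f Ident_Hom[OF Y] Ident_Hom[OF Y]] Ident_Comp[OF f] by simp
  finally show ?thesis
    unfolding imaginary_addition_def
    using Comp_assoc[OF t m nY] Split_natural[OF f f]
      Comp_assoc[OF CovMap_Hom[OF prod_map_Hom[OF f f]] t' nY] by simp
qed

lemma imag_add_Hom:
  assumes a: "a \<in> Hom C (Cov C W) X" and b: "b \<in> Hom C (Cov C W) X" and W: "W \<in> Obj C"
  shows "a \<oplus>\<^bsub>W,X\<^esub> b \<in> Hom C (Cov C W) X"
  unfolding imag_add_def
  using imag_comp_Hom[OF pair_props(1)[OF a b] imaginary_addition_Hom W] Hom_Obj[OF a] by blast

lemma imag_add_comp:
  assumes a: "a \<in> Hom C (Cov C W) X" and b: "b \<in> Hom C (Cov C W) X" and c: "c \<in> Hom C (Cov C V) W"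
    and V: "V \<in> Obj C" and W: "W \<in> Obj C"
  shows "(a \<oplus>\<^bsub>W,X\<^esub> b) \<star>\<^bsub>V\<^esub> c = (a \<star>\<^bsub>V\<^esub> c) \<oplus>\<^bsub>V,X\<^esub> (b \<star>\<^bsub>V\<^esub> c)"
proof -
  have X: "X \<in> Obj C" using Hom_Obj[OF a] by simp
  show ?thesis unfolding imag_add_def
    using imag_comp_assoc[OF c pair_props(1)[OF a b] imaginary_addition_Hom[OF X] V W]
      pair_imag_comp[OF a b c V] by simp
qed

lemma Comp_imag_add:
  assumes a: "a \<in> Hom C (Cov C W) X" and b: "b \<in> Hom C (Cov C W) X" and f: "f \<in> Hom C X Y"
    and W: "W \<in> Obj C"
  shows "f \<cdot> (a \<oplus>\<^bsub>W,X\<^esub> b) = (f \<cdot> a) \<oplus>\<^bsub>W,Y\<^esub> (f \<cdot> b)"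
proof -
  have X: "X \<in> Obj C" and Y: "Y \<in> Obj C" using Hom_Obj[OF f] by auto
  note p = pair_props(1)[OF a b]
  show ?thesis unfolding imag_add_def
    using Comp_imag_comp[OF p imaginary_addition_Hom[OF X] W f] imaginary_addition_natural[OF f]
      imag_comp_real[OF p W prod_map_Hom[OF f f] imaginary_addition_Hom[OF Y]]
      prod_map_pair[OF f f a b] by simp
qed

text \<open>The zero element enters as an element factoring through a zero object \<open>Z\<close>. By naturality of
  the splitting, adding it is computed by \<open>t\<close> followed by \<open>(1 0) : X + Z \<rightarrow> X\<close>, which is the
  first projection after the comparison morphism; so the splitting equation applies.\<close>

lemma imag_add_zero:
  assumes Z: "zero_object C Z" and a: "a \<in> Hom C (Cov C W) X"
    and u: "u \<in> Hom C (Cov C W) Z" and v: "v \<in> Hom C Z X" and W: "W \<in> Obj C"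
  shows "a \<oplus>\<^bsub>W,X\<^esub> (v \<cdot> u) = a"
proof -
  have X: "X \<in> Obj C" and ZO: "Z \<in> Obj C" using Hom_Obj[OF v] by auto
  note i = Ident_Hom[OF X] and t = Split_Hom[OF X ZO]
  note n = copair_props(1)[OF i i] and m = coprod_map_Hom[OF i v] and pm = prod_map_Hom[OF i v]
  have z: "\<zero> Z X = v"
    using zero_mor_eq[OF Z Ident_Hom[OF ZO] v] Comp_Ident[OF v] by simp
  have zz: "\<zero> X Z \<in> Hom C X Z"
    using zero_mor_factorization[OF Z X ZO] Comp_Hom by metis
  have "\<mu> X \<cdot> CovMap C (prod_map C (\<one> X) v) = copair C (\<one> X) v \<cdot> \<tau> X Z"
    unfolding imaginary_addition_def
    using Comp_assoc[OF CovMap_Hom[OF pm] Split_Hom[OF X X] n] Split_natural[OF i v]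
      Comp_assoc[OF t m n] copair_coprod_map[OF i v i i] Ident_Comp[OF i] Ident_Comp[OF v] by simp
  also have "copair C (\<one> X) v = \<pi>\<^sub>1 X Z \<cdot> comparison C X Z"
    unfolding comparison_def z
    using pair_props(2)[OF copair_props(1)[OF i v] copair_props(1)[OF zz Ident_Hom[OF ZO]]] by simp
  also have "\<dots> \<cdot> \<tau> X Z = \<pi>\<^sub>1 X Z \<cdot> \<epsilon> (X \<boxtimes> Z)"
  proof -
    have "comparison C X Z \<in> Hom C (X \<boxplus> Z) (X \<boxtimes> Z)"
      unfolding comparison_def z
      by (rule pair_props(1)[OF copair_props(1)[OF i v] copair_props(1)[OF zz Ident_Hom[OF ZO]]])
    then show ?thesis
      using Comp_assoc[OF t _ Prj_Hom(1)[OF X ZO]] comparison_Split[OF X ZO] by simp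
  qed
  finally have key: "\<mu> X \<cdot> CovMap C (prod_map C (\<one> X) v) = \<pi>\<^sub>1 X Z \<cdot> \<epsilon> (X \<boxtimes> Z)" .
  note p = pair_props[OF a u]
  have XZ: "X \<boxtimes> Z \<in> Obj C" using Hom_Obj[OF p(1)] by simp
  have "a \<oplus>\<^bsub>W,X\<^esub> (v \<cdot> u) = \<mu> X \<star>\<^bsub>W\<^esub> (prod_map C (\<one> X) v \<cdot> pair C a u)"
    unfolding imag_add_def using prod_map_pair[OF i v a u] Ident_Comp[OF a] by simp
  also have "\<dots> = (\<pi>\<^sub>1 X Z \<cdot> \<epsilon> (X \<boxtimes> Z)) \<star>\<^bsub>W\<^esub> pair C a u"
    using imag_comp_real[OF p(1) W pm imaginary_addition_Hom[OF X]] key by simp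
  also have "\<dots> = a"
    using Comp_imag_comp[OF p(1) Eps_Hom[OF XZ] W Prj_Hom(1)[OF X ZO]]
      imag_comp_Eps_left[OF p(1) W] p(2) by simp
  finally show ?thesis .
qed


section \<open>Schreier retractions on imaginary elements\<close>

text \<open>The two Schreier equations at all generalised elements instead of only at the universal ones.
  This form allows the calculations below to substitute freely.\<close>

definition Schreier_retraction where
  "Schreier_retraction K X Y k f s q \<longleftrightarrow> q \<in> Hom C (Cov C X) K \<and>
     (\<forall>W \<in> Obj C. \<forall>x \<in> Hom C (Cov C W) X. (k \<cdot> (q \<star>\<^bsub>W\<^esub> x)) \<oplus>\<^bsub>W,X\<^esub> (s \<cdot> (f \<cdot> x)) = x) \<and>
     (\<forall>W \<in> Obj C. \<forall>c \<in> Hom C (Cov C W) K. \<forall>d \<in> Hom C (Cov C W) Y.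
        q \<star>\<^bsub>W\<^esub> ((k \<cdot> c) \<oplus>\<^bsub>W,X\<^esub> (s \<cdot> d)) = c)"

lemma Schreier_retractionD:
  assumes "Schreier_retraction K X Y k f s q"
  shows "q \<in> Hom C (Cov C X) K"
    and "W \<in> Obj C \<Longrightarrow> x \<in> Hom C (Cov C W) X \<Longrightarrow>
      (k \<cdot> (q \<star>\<^bsub>W\<^esub> x)) \<oplus>\<^bsub>W,X\<^esub> (s \<cdot> (f \<cdot> x)) = x"
    and "W \<in> Obj C \<Longrightarrow> c \<in> Hom C (Cov C W) K \<Longrightarrow> d \<in> Hom C (Cov C W) Y \<Longrightarrow>
      q \<star>\<^bsub>W\<^esub> ((k \<cdot> c) \<oplus>\<^bsub>W,X\<^esub> (s \<cdot> d)) = c"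
  using assms unfolding Schreier_retraction_def by blast+

text \<open>A Yoneda argument in the Kleisli category: the defining equations are the instances of the
  elementwise ones at \<open>x = \<epsilon>\<close> and at the two projections of \<open>K \<times> Y\<close>, and composing these
  instances with \<open>x\<close> and \<open>\<langle>c, d\<rangle>\<close> recovers the general case.\<close>

lemma intrinsic_Schreier_iff:
  assumes S: "split_epi_with_kernel C K X Y k f s"
  shows "intrinsic_Schreier C K X Y k f s \<longleftrightarrow> (\<exists>q. Schreier_retraction K X Y k f s q)"
proof -
  have k: "k \<in> Hom C K X" and f: "f \<in> Hom C X Y" and s: "s \<in> Hom C Y X"
    using S by (auto simp: split_epi_with_kernel_def)
  have K: "K \<in> Obj C" and X: "X \<in> Obj C" and Y: "Y \<in> Obj C"
    using Hom_Obj[OF k] Hom_Obj[OF f] by auto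
  note e = Eps_Hom[OF X] and P = Prj_Hom[OF K Y]
  define KY where "KY = K \<boxtimes> Y"
  have KY: "KY \<in> Obj C" using Hom_Obj[OF P(1)] by (simp add: KY_def)
  note eKY = Eps_Hom[OF KY]
  have p1: "\<pi>\<^sub>1 K Y \<in> Hom C KY K" and p2: "\<pi>\<^sub>2 K Y \<in> Hom C KY Y" using P by (auto simp: KY_def)
  have pm: "prod_map C k s \<in> Hom C KY (X \<boxtimes> X)" using prod_map_Hom[OF k s] by (simp add: KY_def)
  have one: "real_imaginary C (\<one> X) = \<epsilon> X"
    using Ident_Hom[OF X] Ident_Comp[OF e] by (simp add: real_imaginary_def Hom_def)
  have sf: "real_imaginary C (s \<cdot> f) = s \<cdot> (f \<cdot> \<epsilon> X)"
    using Comp_assoc[OF e f s] Comp_Hom[OF f s] by (simp add: real_imaginary_def Hom_def)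
  have pr: "real_imaginary C (\<pi>\<^sub>1 K Y) = \<pi>\<^sub>1 K Y \<cdot> \<epsilon> KY"
    using p1 by (simp add: real_imaginary_def Hom_def)
  have prs: "pair C (\<pi>\<^sub>1 K Y) (\<pi>\<^sub>2 K Y) = \<one> KY"
    using pair_eqI[of "\<one> KY" KY K Y] Ident_Hom[OF KY] Comp_Ident[OF p1] Comp_Ident[OF p2] K Y
    by (simp add: KY_def)
  \<comment> \<open>The composite \<open>\<mu> \<circ> (k \<times> s)\<close> is the sum of the two parts of the universal pair.\<close>
  have univ: "\<mu> X \<cdot> CovMap C (prod_map C k s)
      = (k \<cdot> (\<pi>\<^sub>1 K Y \<cdot> \<epsilon> KY)) \<oplus>\<^bsub>KY,X\<^esub> (s \<cdot> (\<pi>\<^sub>2 K Y \<cdot> \<epsilon> KY))"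
  proof -
    have "pair C (k \<cdot> (\<pi>\<^sub>1 K Y \<cdot> \<epsilon> KY)) (s \<cdot> (\<pi>\<^sub>2 K Y \<cdot> \<epsilon> KY)) = prod_map C k s \<cdot> \<epsilon> KY"
      using prod_map_pair[OF k s Comp_Hom[OF eKY p1] Comp_Hom[OF eKY p2]]
        pair_Comp[OF p1 p2 eKY] prs Ident_Comp[OF eKY] by simp
    then show ?thesis unfolding imag_add_def
      using imag_comp_real_Eps[OF imaginary_addition_Hom[OF X] pm] by simp
  qed
  show ?thesis
  proof
    assume "intrinsic_Schreier C K X Y k f s"
    then obtain q where q: "q \<in> Hom C (Cov C X) K"
      and eq1: "(k \<cdot> q) \<oplus>\<^bsub>X,X\<^esub> (s \<cdot> (f \<cdot> \<epsilon> X)) = \<epsilon> X"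
      and eq2: "q \<star>\<^bsub>KY\<^esub> (\<mu> X \<cdot> CovMap C (prod_map C k s)) = \<pi>\<^sub>1 K Y \<cdot> \<epsilon> KY"
      unfolding intrinsic_Schreier_def imaginary_def one sf pr KY_def[symmetric] imag_add_def by blast
    have "Schreier_retraction K X Y k f s q"
      unfolding Schreier_retraction_def
    proof (intro conjI ballI)
      show "q \<in> Hom C (Cov C X) K" by fact
    next
      fix W x assume W: "W \<in> Obj C" and x: "x \<in> Hom C (Cov C W) X"
      have "x = ((k \<cdot> q) \<oplus>\<^bsub>X,X\<^esub> (s \<cdot> (f \<cdot> \<epsilon> X))) \<star>\<^bsub>W\<^esub> x"
        using imag_comp_Eps_left[OF x W] eq1 by simp
      also have "\<dots> = ((k \<cdot> q) \<star>\<^bsub>W\<^esub> x) \<oplus>\<^bsub>W,X\<^esub> ((s \<cdot> (f \<cdot> \<epsilon> X)) \<star>\<^bsub>W\<^esub> x)"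
        using imag_add_comp[OF Comp_Hom[OF q k] Comp_Hom[OF Comp_Hom[OF e f] s] x W X] .
      also have "(k \<cdot> q) \<star>\<^bsub>W\<^esub> x = k \<cdot> (q \<star>\<^bsub>W\<^esub> x)"
        using Comp_imag_comp[OF x q W k] .
      also have "(s \<cdot> (f \<cdot> \<epsilon> X)) \<star>\<^bsub>W\<^esub> x = s \<cdot> (f \<cdot> x)"
        using Comp_imag_comp[OF x Comp_Hom[OF e f] W s] Comp_imag_comp[OF x e W f]
          imag_comp_Eps_left[OF x W] by simp
      finally show "(k \<cdot> (q \<star>\<^bsub>W\<^esub> x)) \<oplus>\<^bsub>W,X\<^esub> (s \<cdot> (f \<cdot> x)) = x" by simp
    next
      fix W c d assume W: "W \<in> Obj C" and c: "c \<in> Hom C (Cov C W) K" and d: "d \<in> Hom C (Cov C W) Y"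
      note cd = pair_props[OF c d, folded KY_def]
      have "(k \<cdot> c) \<oplus>\<^bsub>W,X\<^esub> (s \<cdot> d) = \<mu> X \<star>\<^bsub>W\<^esub> (prod_map C k s \<cdot> pair C c d)"
        unfolding imag_add_def using prod_map_pair[OF k s c d] by simp
      also have "\<dots> = (\<mu> X \<cdot> CovMap C (prod_map C k s)) \<star>\<^bsub>W\<^esub> pair C c d"
        using imag_comp_real[OF cd(1) W pm imaginary_addition_Hom[OF X]] .
      finally have "q \<star>\<^bsub>W\<^esub> ((k \<cdot> c) \<oplus>\<^bsub>W,X\<^esub> (s \<cdot> d)) = (\<pi>\<^sub>1 K Y \<cdot> \<epsilon> KY) \<star>\<^bsub>W\<^esub> pair C c d"
        using imag_comp_assoc[OF cd(1) Comp_Hom[OF CovMap_Hom[OF pm] imaginary_addition_Hom[OF X]] q W KY]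
          eq2 by simp
      then show "q \<star>\<^bsub>W\<^esub> ((k \<cdot> c) \<oplus>\<^bsub>W,X\<^esub> (s \<cdot> d)) = c"
        using Comp_imag_comp[OF cd(1) eKY W p1] imag_comp_Eps_left[OF cd(1) W] cd(2) by simp
    qed
    then show "\<exists>q. Schreier_retraction K X Y k f s q" ..
  next
    assume "\<exists>q. Schreier_retraction K X Y k f s q"
    then obtain q where R: "Schreier_retraction K X Y k f s q" ..
    note q = Schreier_retractionD(1)[OF R]
    have "(k \<cdot> q) \<oplus>\<^bsub>X,X\<^esub> (s \<cdot> (f \<cdot> \<epsilon> X)) = \<epsilon> X"
      using Schreier_retractionD(2)[OF R X e] imag_comp_Eps_right[OF q X] by simp
    moreover have "q \<star>\<^bsub>KY\<^esub> (\<mu> X \<cdot> CovMap C (prod_map C k s)) = \<pi>\<^sub>1 K Y \<cdot> \<epsilon> KY"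
      unfolding univ
      using Schreier_retractionD(3)[OF R KY Comp_Hom[OF eKY p1] Comp_Hom[OF eKY p2]] .
    ultimately show "intrinsic_Schreier C K X Y k f s"
      unfolding intrinsic_Schreier_def imaginary_def one sf pr KY_def[symmetric] imag_add_def
      using S q by blast
  qed
qed

text \<open>The image under \<open>g\<close> of the decomposition of \<open>x\<close> has the form \<open>k c + s d\<close>, and \<open>q\<close> reads off
  its first part. With identities for the three connecting morphisms this says that a retraction is
  unique.\<close>

lemma Schreier_retraction_natural:
  assumes S': "split_epi_with_kernel C K' X' Y' k' f' s'" and S: "split_epi_with_kernel C K X Y k f s"
    and R': "Schreier_retraction K' X' Y' k' f' s' q'" and R: "Schreier_retraction K X Y k f s q"
    and c: "c \<in> Hom C K' K" and g: "g \<in> Hom C X' X" and h: "h \<in> Hom C Y' Y"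
    and gk: "g \<cdot> k' = k \<cdot> c" and gs: "g \<cdot> s' = s \<cdot> h"
    and W: "W \<in> Obj C" and x: "x \<in> Hom C (Cov C W) X'"
  shows "q \<star>\<^bsub>W\<^esub> (g \<cdot> x) = c \<cdot> (q' \<star>\<^bsub>W\<^esub> x)"
proof -
  have k': "k' \<in> Hom C K' X'" and f': "f' \<in> Hom C X' Y'" and s': "s' \<in> Hom C Y' X'"
    and k: "k \<in> Hom C K X" and s: "s \<in> Hom C Y X"
    using S' S by (auto simp: split_epi_with_kernel_def)
  have y: "q' \<star>\<^bsub>W\<^esub> x \<in> Hom C (Cov C W) K'"
    using imag_comp_Hom[OF x Schreier_retractionD(1)[OF R'] W] .
  have fx: "f' \<cdot> x \<in> Hom C (Cov C W) Y'" using Comp_Hom[OF x f'] .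
  have "g \<cdot> x = g \<cdot> ((k' \<cdot> (q' \<star>\<^bsub>W\<^esub> x)) \<oplus>\<^bsub>W,X'\<^esub> (s' \<cdot> (f' \<cdot> x)))"
    using Schreier_retractionD(2)[OF R' W x] by simp
  also have "\<dots> = (k \<cdot> (c \<cdot> (q' \<star>\<^bsub>W\<^esub> x))) \<oplus>\<^bsub>W,X\<^esub> (s \<cdot> (h \<cdot> (f' \<cdot> x)))"
    using Comp_imag_add[OF Comp_Hom[OF y k'] Comp_Hom[OF fx s'] g W]
      Comp_assoc[OF y k' g] Comp_assoc[OF y c k] Comp_assoc[OF fx s' g] Comp_assoc[OF fx h s] gk gs
    by simp
  finally show ?thesis
    using Schreier_retractionD(3)[OF R W Comp_Hom[OF y c] Comp_Hom[OF fx h]] by simp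
qed

text \<open>The second part of the decomposition of \<open>k c\<close> vanishes because \<open>f k = 0\<close>, and \<open>k\<close> is a
  monomorphism. Requiring just this decomposition makes the lemma usable in proving the second
  Schreier equation for \<open>q\<close>.\<close>

lemma Schreier_retraction_kernel:
  assumes S: "split_epi_with_kernel C K X Y k f s" and W: "W \<in> Obj C"
    and q: "q \<in> Hom C (Cov C X) K" and c: "c \<in> Hom C (Cov C W) K"
    and dec: "(k \<cdot> (q \<star>\<^bsub>W\<^esub> (k \<cdot> c))) \<oplus>\<^bsub>W,X\<^esub> (s \<cdot> (f \<cdot> (k \<cdot> c))) = k \<cdot> c"
  shows "q \<star>\<^bsub>W\<^esub> (k \<cdot> c) = c"
proof -
  have k: "k \<in> Hom C K X" and f: "f \<in> Hom C X Y" and s: "s \<in> Hom C Y X" and ker: "is_kernel C f k"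
    using S by (auto simp: split_epi_with_kernel_def)
  have K: "K \<in> Obj C" and Y: "Y \<in> Obj C" using Hom_Obj[OF k] Hom_Obj[OF f] by auto
  obtain Z where Z: "zero_object C Z" using pointed by (auto simp: pointed_def)
  have fk: "f \<cdot> k = \<zero> K Y" using ker k f by (simp add: is_kernel_def Hom_def)
  obtain u v where u: "u \<in> Hom C K Z" and v: "v \<in> Hom C Z Y" and uv: "\<zero> K Y = v \<cdot> u"
    using zero_mor_factorization[OF Z K Y] .
  have "s \<cdot> (f \<cdot> (k \<cdot> c)) = (s \<cdot> v) \<cdot> (u \<cdot> c)"
    using Comp_assoc[OF c k f] fk uv Comp_assoc[OF c u v] Comp_assoc[OF Comp_Hom[OF c u] v s] by simp
  moreover have y: "q \<star>\<^bsub>W\<^esub> (k \<cdot> c) \<in> Hom C (Cov C W) K"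
    using imag_comp_Hom[OF Comp_Hom[OF c k] q W] .
  ultimately have "k \<cdot> (q \<star>\<^bsub>W\<^esub> (k \<cdot> c)) = k \<cdot> c"
    using dec imag_add_zero[OF Z Comp_Hom[OF y k] Comp_Hom[OF c u] Comp_Hom[OF v s] W] by simp
  then show ?thesis using kernel_cancel[OF Z ker k y c] by simp
qed

end


section \<open>Descent of the Schreier condition\<close>

theorem proposition7p4:
  fixes C :: "('o, 'm) imaginary_category" (structure)
  assumes "regular_category C" and "unital_category C"
    and "chosen_products C" and "chosen_coproducts C"
    and "comonadic_covers C" and "natural_imaginary_splitting C"
    and "\<forall>A \<in> Obj C. projective C (Cov C A)"
    and "split_epi_with_kernel C K' X' Y' k' f' s'"
    and "split_epi_with_kernel C K X Y k f s"
    and "\<gamma> \<in> Hom C K' K" and "g \<in> Hom C X' X" and "h \<in> Hom C Y' Y"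
    and "g \<cdot> k' = k \<cdot> \<gamma>" and "f \<cdot> g = h \<cdot> f'" and "g \<cdot> s' = s \<cdot> h"
    and "is_kernel_pair C \<gamma> E\<^sub>\<gamma> \<gamma>\<^sub>1 \<gamma>\<^sub>2"
    and "is_kernel_pair C g E\<^sub>g g\<^sub>1 g\<^sub>2"
    and "is_kernel_pair C h E\<^sub>h h\<^sub>1 h\<^sub>2"
    and "\<phi> \<in> Hom C E\<^sub>g E\<^sub>h" and "h\<^sub>1 \<cdot> \<phi> = f' \<cdot> g\<^sub>1" and "h\<^sub>2 \<cdot> \<phi> = f' \<cdot> g\<^sub>2"
    and "\<sigma> \<in> Hom C E\<^sub>h E\<^sub>g" and "g\<^sub>1 \<cdot> \<sigma> = s' \<cdot> h\<^sub>1" and "g\<^sub>2 \<cdot> \<sigma> = s' \<cdot> h\<^sub>2"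
    and "\<kappa> \<in> Hom C E\<^sub>\<gamma> E\<^sub>g" and "g\<^sub>1 \<cdot> \<kappa> = k' \<cdot> \<gamma>\<^sub>1" and "g\<^sub>2 \<cdot> \<kappa> = k' \<cdot> \<gamma>\<^sub>2"
    and "intrinsic_Schreier C E\<^sub>\<gamma> E\<^sub>g E\<^sub>h \<kappa> \<phi> \<sigma>"
    and "intrinsic_Schreier C K' X' Y' k' f' s'"
    and "regular_epi C g" and "regular_epi C h"
  shows "intrinsic_Schreier C K X Y k f s"
proof -
  interpret imaginary_splitting_category C
    using assms(2-6)
    unfolding imaginary_splitting_category_def imaginary_splitting_category_axioms_def
      unital_category_def finitely_complete_def comonadic_covers_def by blast
  note S' = assms(8) and S = assms(9) and \<gamma> = assms(10) and g = assms(11) and h = assms(12)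
  have SE: "split_epi_with_kernel C E\<^sub>\<gamma> E\<^sub>g E\<^sub>h \<kappa> \<phi> \<sigma>"
    using assms(28) by (simp add: intrinsic_Schreier_def)
  obtain q' where R': "Schreier_retraction K' X' Y' k' f' s' q'"
    using assms(29) intrinsic_Schreier_iff[OF S'] by blast
  obtain r where RE: "Schreier_retraction E\<^sub>\<gamma> E\<^sub>g E\<^sub>h \<kappa> \<phi> \<sigma> r"
    using assms(28) intrinsic_Schreier_iff[OF SE] by blast
  note q' = Schreier_retractionD(1)[OF R'] and r = Schreier_retractionD(1)[OF RE]
  have k: "k \<in> Hom C K X" and f: "f \<in> Hom C X Y" and s: "s \<in> Hom C Y X"
    and k': "k' \<in> Hom C K' X'" and f': "f' \<in> Hom C X' Y'" and s': "s' \<in> Hom C Y' X'"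
    using S S' by (auto simp: split_epi_with_kernel_def)
  have X: "X \<in> Obj C" using Hom_Obj[OF f] by simp
  note \<gamma>12 = kernel_pair_props[OF assms(16) \<gamma>]
    and g12 = kernel_pair_props[OF assms(17) g] and h12 = kernel_pair_props[OF assms(18) h]

  \<comment> \<open>The candidate value \<open>\<gamma> q'(x)\<close> depends only on \<open>g x\<close>; this is where the kernel pairs enter.\<close>
  have indep: "\<gamma> \<cdot> (q' \<star>\<^bsub>W\<^esub> x) = \<gamma> \<cdot> (q' \<star>\<^bsub>W\<^esub> y)"
    if W: "W \<in> Obj C" and x: "x \<in> Hom C (Cov C W) X'" and y: "y \<in> Hom C (Cov C W) X'"
      and xy: "g \<cdot> x = g \<cdot> y" for W x y
  proof -
    obtain e where e: "e \<in> Hom C (Cov C W) E\<^sub>g" "g\<^sub>1 \<cdot> e = x" "g\<^sub>2 \<cdot> e = y"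
      using kernel_pair_lift[OF assms(17) g x y xy] .
    have re: "r \<star>\<^bsub>W\<^esub> e \<in> Hom C (Cov C W) E\<^sub>\<gamma>" using imag_comp_Hom[OF e(1) r W] .
    have "q' \<star>\<^bsub>W\<^esub> x = \<gamma>\<^sub>1 \<cdot> (r \<star>\<^bsub>W\<^esub> e)"
      using Schreier_retraction_natural[OF SE S' RE R' \<gamma>12(1) g12(1) h12(1) assms(26,23) W e(1)] e(2)
      by simp
    moreover have "q' \<star>\<^bsub>W\<^esub> y = \<gamma>\<^sub>2 \<cdot> (r \<star>\<^bsub>W\<^esub> e)"
      using Schreier_retraction_natural[OF SE S' RE R' \<gamma>12(2) g12(2) h12(2) assms(27,24) W e(1)] e(3)
      by simp
    ultimately show ?thesis
      using Comp_assoc[OF re \<gamma>12(1) \<gamma>] Comp_assoc[OF re \<gamma>12(2) \<gamma>] \<gamma>12(3) by simp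
  qed

  have lift: "\<exists>x' \<in> Hom C (Cov C W) A'. e \<cdot> x' = x"
    if "regular_epi C e" and "e \<in> Hom C A' A" and "W \<in> Obj C" and "x \<in> Hom C (Cov C W) A" for e A' A W x
    using projective_lift assms(7) that by metis
  \<comment> \<open>A lift of the generic element \<open>\<epsilon>\<close> of \<open>X\<close> turns the elementwise recipe into one morphism.\<close>
  obtain l where l: "l \<in> Hom C (Cov C X) X'" and gl: "g \<cdot> l = \<epsilon> X"
    using lift[OF assms(30) g X Eps_Hom[OF X]] by blast
  define q where "q = \<gamma> \<cdot> (q' \<star>\<^bsub>X\<^esub> l)"
  note q'l = imag_comp_Hom[OF l q' X]
  have q: "q \<in> Hom C (Cov C X) K" unfolding q_def using Comp_Hom[OF q'l \<gamma>] .

  have q_image: "q \<star>\<^bsub>W\<^esub> (g \<cdot> x) = \<gamma> \<cdot> (q' \<star>\<^bsub>W\<^esub> x)"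
    if W: "W \<in> Obj C" and x: "x \<in> Hom C (Cov C W) X'" for W x
  proof -
    have gx: "g \<cdot> x \<in> Hom C (Cov C W) X" using Comp_Hom[OF x g] .
    have "q \<star>\<^bsub>W\<^esub> (g \<cdot> x) = \<gamma> \<cdot> (q' \<star>\<^bsub>W\<^esub> (l \<star>\<^bsub>W\<^esub> (g \<cdot> x)))"
      unfolding q_def using Comp_imag_comp[OF gx q'l W \<gamma>] imag_comp_assoc[OF gx l q' W X] by simp
    moreover have "g \<cdot> (l \<star>\<^bsub>W\<^esub> (g \<cdot> x)) = g \<cdot> x"
      using Comp_imag_comp[OF gx l W g] gl imag_comp_Eps_left[OF gx W] by simp
    ultimately show ?thesis using indep[OF W imag_comp_Hom[OF gx l W] x] by simp
  qed

  have push: "g \<cdot> ((k' \<cdot> c) \<oplus>\<^bsub>W,X'\<^esub> (s' \<cdot> d)) = (k \<cdot> (\<gamma> \<cdot> c)) \<oplus>\<^bsub>W,X\<^esub> (s \<cdot> (h \<cdot> d))"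
    if "W \<in> Obj C" and c: "c \<in> Hom C (Cov C W) K'" and d: "d \<in> Hom C (Cov C W) Y'" for W c d
    using Comp_imag_add[OF Comp_Hom[OF c k'] Comp_Hom[OF d s'] g that(1)]
      Comp_assoc[OF c k' g] Comp_assoc[OF c \<gamma> k] Comp_assoc[OF d s' g] Comp_assoc[OF d h s]
      assms(13,15) by simp

  have decomp: "(k \<cdot> (q \<star>\<^bsub>W\<^esub> x)) \<oplus>\<^bsub>W,X\<^esub> (s \<cdot> (f \<cdot> x)) = x"
    if W: "W \<in> Obj C" and x: "x \<in> Hom C (Cov C W) X" for W x
  proof -
    obtain x' where x': "x' \<in> Hom C (Cov C W) X'" and gx: "g \<cdot> x' = x"
      using lift[OF assms(30) g W x] by blast
    have "h \<cdot> (f' \<cdot> x') = f \<cdot> x"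
      using Comp_assoc[OF x' f' h] Comp_assoc[OF x' g f] assms(14) gx by simp
    then show ?thesis
      using push[OF W imag_comp_Hom[OF x' q' W] Comp_Hom[OF x' f']]
        Schreier_retractionD(2)[OF R' W x'] q_image[OF W x'] gx by simp
  qed

  have unique: "q \<star>\<^bsub>W\<^esub> ((k \<cdot> c) \<oplus>\<^bsub>W,X\<^esub> (s \<cdot> d)) = c"
    if W: "W \<in> Obj C" and c: "c \<in> Hom C (Cov C W) K" and d: "d \<in> Hom C (Cov C W) Y" for W c d
  proof -
    note kc = Comp_Hom[OF c k]
    \<comment> \<open>\<open>\<gamma>\<close> is not known to be a regular epimorphism, so \<open>k c\<close> is lifted along \<open>g\<close> and then retracted.\<close>
    obtain a where a: "a \<in> Hom C (Cov C W) X'" and ga: "g \<cdot> a = k \<cdot> c"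
      using lift[OF assms(30) g W kc] by blast
    define c' where "c' = q' \<star>\<^bsub>W\<^esub> a"
    have c': "c' \<in> Hom C (Cov C W) K'" unfolding c'_def using imag_comp_Hom[OF a q' W] .
    have \<gamma>c': "\<gamma> \<cdot> c' = c"
      using q_image[OF W a] ga Schreier_retraction_kernel[OF S W q c decomp[OF W kc]]
      by (simp add: c'_def)
    obtain d' where d': "d' \<in> Hom C (Cov C W) Y'" and hd: "h \<cdot> d' = d"
      using lift[OF assms(31) h W d] by blast
    have x': "(k' \<cdot> c') \<oplus>\<^bsub>W,X'\<^esub> (s' \<cdot> d') \<in> Hom C (Cov C W) X'"
      using imag_add_Hom[OF Comp_Hom[OF c' k'] Comp_Hom[OF d' s'] W] .
    show ?thesis
      using q_image[OF W x'] push[OF W c' d'] Schreier_retractionD(3)[OF R' W c' d'] \<gamma>c' hd by simp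
  qed

  have "Schreier_retraction K X Y k f s q"
    unfolding Schreier_retraction_def using q decomp unique by blast
  then show ?thesis using intrinsic_Schreier_iff[OF S] by blast
qed

end
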